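(* Let $R$ be a Rota-Baxter operator (of weight zero) on an L-dendriform algebra $(A,\triangleright,\triangleleft)$. Then there exists an L-quadri-algebra structure on $A$ defined, for $x,y\in A$, by $$x\searrow y=R(x)\triangleright y,\quad x\nwarrow y=-y\triangleright R(x),\quad x\nearrow y=R(x)\triangleleft y,\quad x\swarrow y=-y\triangleleft R(x).$$ Its transpose is given by $$x\searrow^t y=R(x)\triangleright y,\quad x\nwarrow^t y=-y\triangleright R(x),\quad x\nearrow^t y=-y\triangleleft R(x),\quad x\swarrow^t y=R(x)\triangleleft y.$$ Its symmetries are given by $$x\searrow^a y=R(x)\triangleright y,\quad x\nwarrow^a y=-R(y)\triangleleft x,\quad x\nearrow^a y=x\triangleright R(y),\quad x\swarrow^a y=-y\triangleleft R(x);$$ $$x\searrow^b y=R(x)\triangleright y,\quad x\nwarrow^b y=-R(y)\triangleleft x,\quad x\nearrow^b y=-y\triangleleft R(x),\quad x\swarrow^b y=x\triangleright R(y);$$ $$x\searrow^c y=R(x)\triangleright y,\quad x\nwarrow^c y=x\triangleleft R(y),\quad x\nearrow^c y=x\triangleright R(y),\quad x\swarrow^c y=R(x)\triangleleft y;$$ $$x\searrow^d y=R(x)\triangleright y,\quad x\nwarrow^d y=x\triangleleft R(y),\quad x\nearrow^d y=R(x)\triangleleft y,\quad x\swarrow^d y=x\triangleright R(y).$$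
   Context: All algebras are finite-dimensional over a field of characteristic zero. An L-dendriform algebra $(A,\triangleright,\triangleleft)$ is a vector space $A$ with two bilinear products such that for all $x,y,z\in A$: $x\triangleright(y\triangleright z)-(x\bullet y)\triangleright z=y\triangleright(x\triangleright z)-(y\bullet x)\triangleright z$ and $x\triangleright(y\triangleleft z)-(x\triangleright y)\triangleleft z=y\triangleleft(x\bullet z)-(y\triangleleft x)\triangleleft z$, where $x\bullet y=x\triangleright y+x\triangleleft y$. A Rota-Baxter operator (of weight zero) on $(A,\triangleright,\triangleleft)$ is a linear map $R:A\to A$ with $R(x)\triangleright R(y)=R(R(x)\triangleright y+x\triangleright R(y))$ and $R(x)\triangleleft R(y)=R(R(x)\triangleleft y+x\triangleleft R(y))$ for all $x,y\in A$. An L-quadri-algebra $(A,\searrow,\nearrow,\nwarrow,\swarrow)$ is a vector space with four bilinear products such that for all $x,y,z\in A$: $x\searrow(y\searrow z)-(x\ast y)\searrow z=y\searrow(x\searrow z)-(y\ast x)\searrow z$; $x\searrow(y\nearrow z)-(x\vee y)\nearrow z=y\nearrow(x\succ z)-(y\wedge x)\nearrow z$; $x\searrow(y\nwarrow z)-(x\searrow y)\nwarrow z=y\nwarrow(x\ast z)-(y\nwarrow x)\nwarrow z$; $x\nearrow(y\prec z)-(x\nearrow y)\nwarrow z=y\swarrow(x\wedge z)-(y\swarrow x)\nwarrow z$; $x\searrow(y\swarrow z)-(x\succ y)\swarrow z=y\swarrow(x\vee z)-(y\prec x)\swarrow z$; where $x\succ y=x\searrow y+x\nearrow y$, $x\prec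 y=x\nwarrow y+x\swarrow y$, $x\vee y=x\searrow y+x\swarrow y$, $x\wedge y=x\nearrow y+x\nwarrow y$, $x\ast y=x\searrow y+x\nearrow y+x\nwarrow y+x\swarrow y$. The transpose and the symmetries $Sym^a,Sym^b,Sym^c,Sym^d$ of an L-quadri-algebra are the L-quadri-algebra structures $(\searrow^s,\nearrow^s,\nwarrow^s,\swarrow^s)$ on $A$, $s=t,a,b,c,d$, where $\searrow^s=\searrow$ always and: $x\nwarrow^t y=x\nwarrow y$, $x\nearrow^t y=x\swarrow y$, $x\swarrow^t y=x\nearrow y$; $x\nwarrow^a y=-y\nearrow x$, $x\nearrow^a y=-y\nwarrow x$, $x\swarrow^a y=x\swarrow y$; $x\nwarrow^b y=-y\nearrow x$, $x\nearrow^b y=x\swarrow y$, $x\swarrow^b y=-y\nwarrow x$; $x\nwarrow^c y=-y\swarrow x$, $x\nearrow^c y=-y\nwarrow x$, $x\swarrow^c y=x\nearrow y$; $x\nwarrow^d y=-y\swarrow x$, $x\nearrow^d y=x\nearrow y$, $x\swarrow^d y=-y\nwarrow x$. *)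

theory Defs
  imports Complex_Main
begin

text \<open>The underlying vector space of an algebra is a whole type, with scalar multiplication
  \<open>scale\<close>. The library's locale \<open>finite_dimensional_vector_space\<close> carries a chosen
  basis as a parameter; no basis is part of the structure here, so it is quantified away.\<close>

locale fin_dim_space = vector_space scale
  for scale :: "'k::field_char_0 \<Rightarrow> 'a::ab_group_add \<Rightarrow> 'a" +
  assumes finite_dimensional: "\<exists>B. finite_dimensional_vector_space scale B"

definition bilinear_product ::
  "('k::field_char_0 \<Rightarrow> 'a::ab_group_add \<Rightarrow> 'a) \<Rightarrow> ('a \<Rightarrow> 'a \<Rightarrow> 'a) \<Rightarrow> bool" where
  "bilinear_product scale m \<longleftrightarrow>
     (\<forall>x. Vector_Spaces.linear scale scale (\<lambda>y. m x y)) \<and>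
     (\<forall>y. Vector_Spaces.linear scale scale (\<lambda>x. m x y))"

text \<open>In the axioms, \<open>x \<triangleright> y + x \<triangleleft> y\<close> is the product usually written with a bullet.\<close>

locale L_dendriform_algebra = fin_dim_space scale
  for scale :: "'k::field_char_0 \<Rightarrow> 'a::ab_group_add \<Rightarrow> 'a" +
  fixes rtri :: "'a \<Rightarrow> 'a \<Rightarrow> 'a" (infixl \<open>\<triangleright>\<close> 70)
    and ltri :: "'a \<Rightarrow> 'a \<Rightarrow> 'a" (infixl \<open>\<triangleleft>\<close> 70)
  assumes bilinear_rtri: "bilinear_product scale (\<triangleright>)"
    and bilinear_ltri: "bilinear_product scale (\<triangleleft>)"
    and L_dend1: "x \<triangleright> (y \<triangleright> z) - (x \<triangleright> y + x \<triangleleft> y) \<triangleright> z = y \<triangleright> (x \<triangleright> z) - (y \<triangleright> x + y \<triangleleft> x) \<triangleright> z"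
    and L_dend2: "x \<triangleright> (y \<triangleleft> z) - (x \<triangleright> y) \<triangleleft> z = y \<triangleleft> (x \<triangleright> z + x \<triangleleft> z) - (y \<triangleleft> x) \<triangleleft> z"

definition rota_baxter_operator ::
  "('k::field_char_0 \<Rightarrow> 'a::ab_group_add \<Rightarrow> 'a) \<Rightarrow> ('a \<Rightarrow> 'a \<Rightarrow> 'a) \<Rightarrow> ('a \<Rightarrow> 'a \<Rightarrow> 'a) \<Rightarrow> ('a \<Rightarrow> 'a) \<Rightarrow> bool"
  where
  "rota_baxter_operator scale rtri ltri R \<longleftrightarrow>
     Vector_Spaces.linear scale scale R \<and>
     (\<forall>x y. rtri (R x) (R y) = R (rtri (R x) y + rtri x (R y))) \<and>
     (\<forall>x y. ltri (R x) (R y) = R (ltri (R x) y + ltri x (R y)))"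

record 'a quadri =
  se :: "'a \<Rightarrow> 'a \<Rightarrow> 'a" (infixl \<open>\<searrow>\<index>\<close> 70)
  ne :: "'a \<Rightarrow> 'a \<Rightarrow> 'a" (infixl \<open>\<nearrow>\<index>\<close> 70)
  nw :: "'a \<Rightarrow> 'a \<Rightarrow> 'a" (infixl \<open>\<nwarrow>\<index>\<close> 70)
  sw :: "'a \<Rightarrow> 'a \<Rightarrow> 'a" (infixl \<open>\<swarrow>\<index>\<close> 70)

text \<open>The horizontal and vertical sums; \<open>\<curlyvee>\<close> and \<open>\<curlywedge>\<close> stand for what is usually written
  with the symbols of disjunction and conjunction, and \<open>\<star>\<close> for the asterisk product.\<close>

definition q_succ :: "'a::ab_group_add quadri \<Rightarrow> 'a \<Rightarrow> 'a \<Rightarrow> 'a" (infixl \<open>\<succ>\<index>\<close> 70) where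
  "x \<succ>\<^bsub>Q\<^esub> y = x \<searrow>\<^bsub>Q\<^esub> y + x \<nearrow>\<^bsub>Q\<^esub> y"

definition q_prec :: "'a::ab_group_add quadri \<Rightarrow> 'a \<Rightarrow> 'a \<Rightarrow> 'a" (infixl \<open>\<prec>\<index>\<close> 70) where
  "x \<prec>\<^bsub>Q\<^esub> y = x \<nwarrow>\<^bsub>Q\<^esub> y + x \<swarrow>\<^bsub>Q\<^esub> y"

definition q_vee :: "'a::ab_group_add quadri \<Rightarrow> 'a \<Rightarrow> 'a \<Rightarrow> 'a" (infixl \<open>\<curlyvee>\<index>\<close> 70) where
  "x \<curlyvee>\<^bsub>Q\<^esub> y = x \<searrow>\<^bsub>Q\<^esub> y + x \<swarrow>\<^bsub>Q\<^esub> y"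

definition q_wedge :: "'a::ab_group_add quadri \<Rightarrow> 'a \<Rightarrow> 'a \<Rightarrow> 'a" (infixl \<open>\<curlywedge>\<index>\<close> 70) where
  "x \<curlywedge>\<^bsub>Q\<^esub> y = x \<nearrow>\<^bsub>Q\<^esub> y + x \<nwarrow>\<^bsub>Q\<^esub> y"

definition q_ast :: "'a::ab_group_add quadri \<Rightarrow> 'a \<Rightarrow> 'a \<Rightarrow> 'a" (infixl \<open>\<star>\<index>\<close> 70) where
  "x \<star>\<^bsub>Q\<^esub> y = x \<searrow>\<^bsub>Q\<^esub> y + x \<nearrow>\<^bsub>Q\<^esub> y + x \<nwarrow>\<^bsub>Q\<^esub> y + x \<swarrow>\<^bsub>Q\<^esub> y"

locale L_quadri_algebra = fin_dim_space scale
  for scale :: "'k::field_char_0 \<Rightarrow> 'a::ab_group_add \<Rightarrow> 'a" +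
  fixes Q :: "'a quadri" (structure)
  assumes bilinear_se: "bilinear_product scale (se Q)"
    and bilinear_ne: "bilinear_product scale (ne Q)"
    and bilinear_nw: "bilinear_product scale (nw Q)"
    and bilinear_sw: "bilinear_product scale (sw Q)"
    and L_quad1: "x \<searrow> (y \<searrow> z) - (x \<star> y) \<searrow> z = y \<searrow> (x \<searrow> z) - (y \<star> x) \<searrow> z"
    and L_quad2: "x \<searrow> (y \<nearrow> z) - (x \<curlyvee> y) \<nearrow> z = y \<nearrow> (x \<succ> z) - (y \<curlywedge> x) \<nearrow> z"
    and L_quad3: "x \<searrow> (y \<nwarrow> z) - (x \<searrow> y) \<nwarrow> z = y \<nwarrow> (x \<star> z) - (y \<nwarrow> x) \<nwarrow> z"
    and L_quad4: "x \<nearrow> (y \<prec> z) - (x \<nearrow> y) \<nwarrow> z = y \<swarrow> (x \<curlywedge> z) - (y \<swarrow> x) \<nwarrow> z"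
    and L_quad5: "x \<searrow> (y \<swarrow> z) - (x \<succ> y) \<swarrow> z = y \<swarrow> (x \<curlyvee> z) - (y \<prec> x) \<swarrow> z"

definition transpose_quadri :: "'a::ab_group_add quadri \<Rightarrow> 'a quadri" where
  "transpose_quadri Q =
     \<lparr> se = (\<lambda>x y. x \<searrow>\<^bsub>Q\<^esub> y),
       ne = (\<lambda>x y. x \<swarrow>\<^bsub>Q\<^esub> y),
       nw = (\<lambda>x y. x \<nwarrow>\<^bsub>Q\<^esub> y),
       sw = (\<lambda>x y. x \<nearrow>\<^bsub>Q\<^esub> y) \<rparr>"

definition Sym_a :: "'a::ab_group_add quadri \<Rightarrow> 'a quadri" where
  "Sym_a Q =
     \<lparr> se = (\<lambda>x y. x \<searrow>\<^bsub>Q\<^esub> y),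
       ne = (\<lambda>x y. - (y \<nwarrow>\<^bsub>Q\<^esub> x)),
       nw = (\<lambda>x y. - (y \<nearrow>\<^bsub>Q\<^esub> x)),
       sw = (\<lambda>x y. x \<swarrow>\<^bsub>Q\<^esub> y) \<rparr>"

definition Sym_b :: "'a::ab_group_add quadri \<Rightarrow> 'a quadri" where
  "Sym_b Q =
     \<lparr> se = (\<lambda>x y. x \<searrow>\<^bsub>Q\<^esub> y),
       ne = (\<lambda>x y. x \<swarrow>\<^bsub>Q\<^esub> y),
       nw = (\<lambda>x y. - (y \<nearrow>\<^bsub>Q\<^esub> x)),
       sw = (\<lambda>x y. - (y \<nwarrow>\<^bsub>Q\<^esub> x)) \<rparr>"

definition Sym_c :: "'a::ab_group_add quadri \<Rightarrow> 'a quadri" where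
  "Sym_c Q =
     \<lparr> se = (\<lambda>x y. x \<searrow>\<^bsub>Q\<^esub> y),
       ne = (\<lambda>x y. - (y \<nwarrow>\<^bsub>Q\<^esub> x)),
       nw = (\<lambda>x y. - (y \<swarrow>\<^bsub>Q\<^esub> x)),
       sw = (\<lambda>x y. x \<nearrow>\<^bsub>Q\<^esub> y) \<rparr>"

definition Sym_d :: "'a::ab_group_add quadri \<Rightarrow> 'a quadri" where
  "Sym_d Q =
     \<lparr> se = (\<lambda>x y. x \<searrow>\<^bsub>Q\<^esub> y),
       ne = (\<lambda>x y. x \<nearrow>\<^bsub>Q\<^esub> y),
       nw = (\<lambda>x y. - (y \<swarrow>\<^bsub>Q\<^esub> x)),
       sw = (\<lambda>x y. - (y \<nwarrow>\<^bsub>Q\<^esub> x)) \<rparr>"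

end

theory Submission
  imports Defs
begin

text \<open>Substituting the products into the L-quadri-algebra axioms and using the Rota-Baxter identity to
  collect pairs such as \<open>R (R x \<triangleright> y) + R (x \<triangleright> R y)\<close> into \<open>R x \<triangleright> R y\<close>, the axioms 1 and 3 become the first
  L-dendriform axiom, and the axioms 2, 4 and 5 the second one. The transpose and \<open>Sym\<^sup>a\<close> preserve
  L-quadri-algebras, and they generate the other three symmetries.\<close>

text \<open>The negated opposite product is the only new shape that occurs: in the symmetries and,
  after precomposition with \<open>R\<close>, in \<open>nw\<close> and \<open>sw\<close> of the
  Rota-Baxter construction.\<close>

lemma bilinear_product_uminus_swap:
  assumes "bilinear_product scale m"
  shows "bilinear_product scale (\<lambda>x y. - m y x)"
  using assms
  by (simp add: bilinear_product_def Vector_Spaces.linear_iff module.scale_minus_right module_iff_vector_space)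

lemma bilinear_product_comp_left:
  assumes "bilinear_product scale m" "Vector_Spaces.linear scale scale R"
  shows "bilinear_product scale (\<lambda>x y. m (R x) y)"
  using assms Vector_Spaces.linear_compose[OF assms(2), unfolded o_def]
  by (auto simp: bilinear_product_def)

lemma bilinear_product_additive:
  assumes "bilinear_product scale m"
  shows "m x (y + z) = m x y + m x z" "m (x + y) z = m x z + m y z"
    "m x (y - z) = m x y - m x z" "m (x - y) z = m x z - m y z"
    "m x (- y) = - m x y" "m (- x) y = - m x y"
proof -
  have lin: "Vector_Spaces.linear scale scale (m x)" "Vector_Spaces.linear scale scale (\<lambda>x. m x y)" for x y
    using assms by (simp_all add: bilinear_product_def)
  \<comment> \<open>After its two vector-space components, the third component of
    \<open>Vector_Spaces.linear\<close> is \<open>module_hom\<close>.\<close>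
  note hom = lin[THEN Vector_Spaces.linear.axioms(3)]
  show "m x (y + z) = m x y + m x z" "m x (y - z) = m x y - m x z" "m x (- y) = - m x y"
    by (rule module_hom.add[OF hom(1)] module_hom.diff[OF hom(1)] module_hom.neg[OF hom(1)])+
  show "m (x + y) z = m x z + m y z" "m (x - y) z = m x z - m y z" "m (- x) y = - m x y"
    by (rule module_hom.add[OF hom(2)] module_hom.diff[OF hom(2)] module_hom.neg[OF hom(2)])+
qed

context L_quadri_algebra
begin

lemmas bilinear_simps =
  bilinear_product_additive[OF bilinear_se] bilinear_product_additive[OF bilinear_ne]
  bilinear_product_additive[OF bilinear_nw] bilinear_product_additive[OF bilinear_sw]

lemmas sums_def = q_succ_def q_prec_def q_vee_def q_wedge_def q_ast_def

text \<open>Exchanging \<open>ne\<close> and \<open>sw\<close> interchanges \<succ> with \<curlyvee>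
  and \<prec> with \<curlywedge>, and leaves \<star> unchanged. Hence axioms 2 and 5 trade places, 1
  and 3 are fixed, and 4 returns with \<open>x\<close> and \<open>y\<close> exchanged and its sides
  reversed.\<close>

lemma transpose: "L_quadri_algebra scale (transpose_quadri Q)"
proof
  fix x y z
  note defs = transpose_quadri_def sums_def bilinear_simps
  let ?T = "transpose_quadri Q"
  show "bilinear_product scale (se ?T)" "bilinear_product scale (ne ?T)"
       "bilinear_product scale (nw ?T)" "bilinear_product scale (sw ?T)"
    by (simp_all add: transpose_quadri_def bilinear_se bilinear_ne bilinear_nw bilinear_sw)
  show "x \<searrow>\<^bsub>?T\<^esub> (y \<searrow>\<^bsub>?T\<^esub> z) - (x \<star>\<^bsub>?T\<^esub> y) \<searrow>\<^bsub>?T\<^esub> z = y \<searrow>\<^bsub>?T\<^esub> (x \<searrow>\<^bsub>?T\<^esub> z) - (y \<star>\<^bsub>?T\<^esub> x) \<searrow>\<^bsub>?T\<^esub> z"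
    using L_quad1[of x y z] by (simp add: defs algebra_simps)
  show "x \<searrow>\<^bsub>?T\<^esub> (y \<nearrow>\<^bsub>?T\<^esub> z) - (x \<curlyvee>\<^bsub>?T\<^esub> y) \<nearrow>\<^bsub>?T\<^esub> z = y \<nearrow>\<^bsub>?T\<^esub> (x \<succ>\<^bsub>?T\<^esub> z) - (y \<curlywedge>\<^bsub>?T\<^esub> x) \<nearrow>\<^bsub>?T\<^esub> z"
    using L_quad5[of x y z] by (simp add: defs algebra_simps)
  show "x \<searrow>\<^bsub>?T\<^esub> (y \<nwarrow>\<^bsub>?T\<^esub> z) - (x \<searrow>\<^bsub>?T\<^esub> y) \<nwarrow>\<^bsub>?T\<^esub> z = y \<nwarrow>\<^bsub>?T\<^esub> (x \<star>\<^bsub>?T\<^esub> z) - (y \<nwarrow>\<^bsub>?T\<^esub> x) \<nwarrow>\<^bsub>?T\<^esub> z"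
    using L_quad3[of x y z] by (simp add: defs algebra_simps)
  show "x \<nearrow>\<^bsub>?T\<^esub> (y \<prec>\<^bsub>?T\<^esub> z) - (x \<nearrow>\<^bsub>?T\<^esub> y) \<nwarrow>\<^bsub>?T\<^esub> z = y \<swarrow>\<^bsub>?T\<^esub> (x \<curlywedge>\<^bsub>?T\<^esub> z) - (y \<swarrow>\<^bsub>?T\<^esub> x) \<nwarrow>\<^bsub>?T\<^esub> z"
    using L_quad4[of y x z] by (simp add: defs algebra_simps)
  show "x \<searrow>\<^bsub>?T\<^esub> (y \<swarrow>\<^bsub>?T\<^esub> z) - (x \<succ>\<^bsub>?T\<^esub> y) \<swarrow>\<^bsub>?T\<^esub> z = y \<swarrow>\<^bsub>?T\<^esub> (x \<curlyvee>\<^bsub>?T\<^esub> z) - (y \<prec>\<^bsub>?T\<^esub> x) \<swarrow>\<^bsub>?T\<^esub> z"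
    using L_quad2[of x y z] by (simp add: defs algebra_simps)
qed

text \<open>Reversing the products moves \<open>y\<close> and \<open>z\<close> past each other, so
  axioms 2 and 3 trade places under that exchange, and axiom 4 returns to itself with
  \<open>x\<close> and \<open>z\<close> exchanged. Axioms 1 and 5 persist because they involve
  \<star> and \<succ>, \<prec> only through \<open>x \<star> y - y \<star> x\<close> and
  \<open>x \<succ> y - y \<prec> x\<close>, which do not change.\<close>

lemma Sym_a: "L_quadri_algebra scale (Sym_a Q)"
proof
  fix x y z
  note defs = Sym_a_def sums_def bilinear_simps
  let ?S = "Sym_a Q"
  show "bilinear_product scale (se ?S)" "bilinear_product scale (ne ?S)"
       "bilinear_product scale (nw ?S)" "bilinear_product scale (sw ?S)"
    by (simp_all add: Sym_a_def bilinear_se bilinear_ne bilinear_nw bilinear_sw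
        bilinear_product_uminus_swap)
  show "x \<searrow>\<^bsub>?S\<^esub> (y \<searrow>\<^bsub>?S\<^esub> z) - (x \<star>\<^bsub>?S\<^esub> y) \<searrow>\<^bsub>?S\<^esub> z = y \<searrow>\<^bsub>?S\<^esub> (x \<searrow>\<^bsub>?S\<^esub> z) - (y \<star>\<^bsub>?S\<^esub> x) \<searrow>\<^bsub>?S\<^esub> z"
    using L_quad1[of x y z] by (simp add: defs algebra_simps)
  show "x \<searrow>\<^bsub>?S\<^esub> (y \<nearrow>\<^bsub>?S\<^esub> z) - (x \<curlyvee>\<^bsub>?S\<^esub> y) \<nearrow>\<^bsub>?S\<^esub> z = y \<nearrow>\<^bsub>?S\<^esub> (x \<succ>\<^bsub>?S\<^esub> z) - (y \<curlywedge>\<^bsub>?S\<^esub> x) \<nearrow>\<^bsub>?S\<^esub> z"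
    using L_quad3[of x z y] by (simp add: defs algebra_simps)
  show "x \<searrow>\<^bsub>?S\<^esub> (y \<nwarrow>\<^bsub>?S\<^esub> z) - (x \<searrow>\<^bsub>?S\<^esub> y) \<nwarrow>\<^bsub>?S\<^esub> z = y \<nwarrow>\<^bsub>?S\<^esub> (x \<star>\<^bsub>?S\<^esub> z) - (y \<nwarrow>\<^bsub>?S\<^esub> x) \<nwarrow>\<^bsub>?S\<^esub> z"
    using L_quad2[of x z y] by (simp add: defs algebra_simps)
  show "x \<nearrow>\<^bsub>?S\<^esub> (y \<prec>\<^bsub>?S\<^esub> z) - (x \<nearrow>\<^bsub>?S\<^esub> y) \<nwarrow>\<^bsub>?S\<^esub> z = y \<swarrow>\<^bsub>?S\<^esub> (x \<curlywedge>\<^bsub>?S\<^esub> z) - (y \<swarrow>\<^bsub>?S\<^esub> x) \<nwarrow>\<^bsub>?S\<^esub> z"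
    using L_quad4[of z y x] by (simp add: defs algebra_simps)
  show "x \<searrow>\<^bsub>?S\<^esub> (y \<swarrow>\<^bsub>?S\<^esub> z) - (x \<succ>\<^bsub>?S\<^esub> y) \<swarrow>\<^bsub>?S\<^esub> z = y \<swarrow>\<^bsub>?S\<^esub> (x \<curlyvee>\<^bsub>?S\<^esub> z) - (y \<prec>\<^bsub>?S\<^esub> x) \<swarrow>\<^bsub>?S\<^esub> z"
    using L_quad5[of x y z] by (simp add: defs algebra_simps)
qed

end

text \<open>Put \<open>n x y = - (y \<nwarrow> x)\<close>. The transpose swaps \<open>ne\<close>
  with \<open>sw\<close>, and \<open>Sym_a\<close> swaps \<open>ne\<close> with \<open>n\<close>.
  These two transpositions generate all permutations of the three products, so each remaining
  symmetry is a word in them.\<close>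

lemma Sym_b_eq: "Sym_b Q = transpose_quadri (Sym_a Q)"
  by (simp add: Sym_a_def Sym_b_def transpose_quadri_def)

lemma Sym_c_eq: "Sym_c Q = Sym_a (transpose_quadri Q)"
  by (simp add: Sym_a_def Sym_c_def transpose_quadri_def)

lemma Sym_d_eq: "Sym_d Q = transpose_quadri (Sym_a (transpose_quadri Q))"
  by (simp add: Sym_a_def Sym_d_def transpose_quadri_def)

text \<open>In every axiom \<open>x\<close> and \<open>y\<close> end up under \<open>R\<close> while
  \<open>z\<close> stays bare. The position of \<open>z\<close> in the L-dendriform identity used is
  last for axioms 1 and 2, middle for 3 and 5, first for 4.\<close>

lemma (in L_dendriform_algebra) rota_baxter_L_quadri_algebra:
  assumes "rota_baxter_operator scale (\<triangleright>) (\<triangleleft>) R"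
  defines "Q \<equiv> \<lparr> se = (\<lambda>x y. R x \<triangleright> y), ne = (\<lambda>x y. R x \<triangleleft> y),
                 nw = (\<lambda>x y. - (y \<triangleright> R x)), sw = (\<lambda>x y. - (y \<triangleleft> R x)) \<rparr>"
  shows "L_quadri_algebra scale Q"
proof
  fix x y z
  have R_lin: "Vector_Spaces.linear scale scale R"
    and RB: "R x \<triangleright> R y = R (R x \<triangleright> y + x \<triangleright> R y)" "R x \<triangleleft> R y = R (R x \<triangleleft> y + x \<triangleleft> R y)" for x y
    using assms(1) by (auto simp: rota_baxter_operator_def)
  note hom = R_lin[THEN Vector_Spaces.linear.axioms(3)]
  note R_simps = module_hom.add[OF hom] module_hom.diff[OF hom] module_hom.neg[OF hom]
  note bilinear_simps = bilinear_product_additive[OF bilinear_rtri] bilinear_product_additive[OF bilinear_ltri]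
  \<comment> \<open>Additivity of \<open>R\<close> splits the sum in \<open>RB\<close>, so the
    identity is solved for one summand to serve as a rewrite rule. The leftover terms
    \<open>R (x \<triangleright> R y)\<close> and \<open>R (x \<triangleleft> R y)\<close> cancel in
    each axiom.\<close>
  have RB': "R (R x \<triangleright> y) = R x \<triangleright> R y - R (x \<triangleright> R y)" "R (R x \<triangleleft> y) = R x \<triangleleft> R y - R (x \<triangleleft> R y)" for x y
    by (simp_all add: RB R_simps)
  note defs = Q_def q_succ_def q_prec_def q_vee_def q_wedge_def q_ast_def bilinear_simps R_simps RB'
  have neg: "bilinear_product scale (\<lambda>x y. - m y (R x))"
    if "bilinear_product scale m" for m
    using bilinear_product_comp_left[OF bilinear_product_uminus_swap[OF that] R_lin] .
  show "bilinear_product scale (se Q)" "bilinear_product scale (ne Q)"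
       "bilinear_product scale (nw Q)" "bilinear_product scale (sw Q)"
    by (simp_all add: Q_def neg bilinear_rtri bilinear_ltri bilinear_product_comp_left R_lin)
  show "x \<searrow>\<^bsub>Q\<^esub> (y \<searrow>\<^bsub>Q\<^esub> z) - (x \<star>\<^bsub>Q\<^esub> y) \<searrow>\<^bsub>Q\<^esub> z = y \<searrow>\<^bsub>Q\<^esub> (x \<searrow>\<^bsub>Q\<^esub> z) - (y \<star>\<^bsub>Q\<^esub> x) \<searrow>\<^bsub>Q\<^esub> z"
    using L_dend1[of "R x" "R y" z] by (simp add: defs algebra_simps)
  show "x \<searrow>\<^bsub>Q\<^esub> (y \<nearrow>\<^bsub>Q\<^esub> z) - (x \<curlyvee>\<^bsub>Q\<^esub> y) \<nearrow>\<^bsub>Q\<^esub> z = y \<nearrow>\<^bsub>Q\<^esub> (x \<succ>\<^bsub>Q\<^esub> z) - (y \<curlywedge>\<^bsub>Q\<^esub> x) \<nearrow>\<^bsub>Q\<^esub> z"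
    using L_dend2[of "R x" "R y" z] by (simp add: defs algebra_simps)
  show "x \<searrow>\<^bsub>Q\<^esub> (y \<nwarrow>\<^bsub>Q\<^esub> z) - (x \<searrow>\<^bsub>Q\<^esub> y) \<nwarrow>\<^bsub>Q\<^esub> z = y \<nwarrow>\<^bsub>Q\<^esub> (x \<star>\<^bsub>Q\<^esub> z) - (y \<nwarrow>\<^bsub>Q\<^esub> x) \<nwarrow>\<^bsub>Q\<^esub> z"
    using L_dend1[of "R x" z "R y"] by (simp add: defs algebra_simps)
  show "x \<nearrow>\<^bsub>Q\<^esub> (y \<prec>\<^bsub>Q\<^esub> z) - (x \<nearrow>\<^bsub>Q\<^esub> y) \<nwarrow>\<^bsub>Q\<^esub> z = y \<swarrow>\<^bsub>Q\<^esub> (x \<curlywedge>\<^bsub>Q\<^esub> z) - (y \<swarrow>\<^bsub>Q\<^esub> x) \<nwarrow>\<^bsub>Q\<^esub> z"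
    using L_dend2[of z "R x" "R y"] by (simp add: defs algebra_simps)
  show "x \<searrow>\<^bsub>Q\<^esub> (y \<swarrow>\<^bsub>Q\<^esub> z) - (x \<succ>\<^bsub>Q\<^esub> y) \<swarrow>\<^bsub>Q\<^esub> z = y \<swarrow>\<^bsub>Q\<^esub> (x \<curlyvee>\<^bsub>Q\<^esub> z) - (y \<prec>\<^bsub>Q\<^esub> x) \<swarrow>\<^bsub>Q\<^esub> z"
    using L_dend2[of "R x" z "R y"] by (simp add: defs algebra_simps)
qed

theorem corollary3p12:
  fixes scale :: "'k::field_char_0 \<Rightarrow> 'a::ab_group_add \<Rightarrow> 'a"
    and rtri :: "'a \<Rightarrow> 'a \<Rightarrow> 'a" (infixl \<open>\<triangleright>\<close> 70)
    and ltri :: "'a \<Rightarrow> 'a \<Rightarrow> 'a" (infixl \<open>\<triangleleft>\<close> 70)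
    and R :: "'a \<Rightarrow> 'a"
  assumes "L_dendriform_algebra scale (\<triangleright>) (\<triangleleft>)"
    and "rota_baxter_operator scale (\<triangleright>) (\<triangleleft>) R"
  shows "\<exists>Q :: 'a quadri.
      L_quadri_algebra scale Q \<and>
      (\<forall>x y. x \<searrow>\<^bsub>Q\<^esub> y = R x \<triangleright> y \<and> x \<nwarrow>\<^bsub>Q\<^esub> y = - (y \<triangleright> R x) \<and>
             x \<nearrow>\<^bsub>Q\<^esub> y = R x \<triangleleft> y \<and> x \<swarrow>\<^bsub>Q\<^esub> y = - (y \<triangleleft> R x)) \<and>
      (let T = transpose_quadri Q in
        L_quadri_algebra scale T \<and>
        (\<forall>x y. x \<searrow>\<^bsub>T\<^esub> y = R x \<triangleright> y \<and> x \<nwarrow>\<^bsub>T\<^esub> y = - (y \<triangleright> R x) \<and>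
               x \<nearrow>\<^bsub>T\<^esub> y = - (y \<triangleleft> R x) \<and> x \<swarrow>\<^bsub>T\<^esub> y = R x \<triangleleft> y)) \<and>
      (let S = Sym_a Q in
        L_quadri_algebra scale S \<and>
        (\<forall>x y. x \<searrow>\<^bsub>S\<^esub> y = R x \<triangleright> y \<and> x \<nwarrow>\<^bsub>S\<^esub> y = - (R y \<triangleleft> x) \<and>
               x \<nearrow>\<^bsub>S\<^esub> y = x \<triangleright> R y \<and> x \<swarrow>\<^bsub>S\<^esub> y = - (y \<triangleleft> R x))) \<and>
      (let S = Sym_b Q in
        L_quadri_algebra scale S \<and>
        (\<forall>x y. x \<searrow>\<^bsub>S\<^esub> y = R x \<triangleright> y \<and> x \<nwarrow>\<^bsub>S\<^esub> y = - (R y \<triangleleft> x) \<and>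
               x \<nearrow>\<^bsub>S\<^esub> y = - (y \<triangleleft> R x) \<and> x \<swarrow>\<^bsub>S\<^esub> y = x \<triangleright> R y)) \<and>
      (let S = Sym_c Q in
        L_quadri_algebra scale S \<and>
        (\<forall>x y. x \<searrow>\<^bsub>S\<^esub> y = R x \<triangleright> y \<and> x \<nwarrow>\<^bsub>S\<^esub> y = x \<triangleleft> R y \<and>
               x \<nearrow>\<^bsub>S\<^esub> y = x \<triangleright> R y \<and> x \<swarrow>\<^bsub>S\<^esub> y = R x \<triangleleft> y)) \<and>
      (let S = Sym_d Q in
        L_quadri_algebra scale S \<and>
        (\<forall>x y. x \<searrow>\<^bsub>S\<^esub> y = R x \<triangleright> y \<and> x \<nwarrow>\<^bsub>S\<^esub> y = x \<triangleleft> R y \<and>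
               x \<nearrow>\<^bsub>S\<^esub> y = R x \<triangleleft> y \<and> x \<swarrow>\<^bsub>S\<^esub> y = x \<triangleright> R y))"
proof -
  let ?Q = "\<lparr> se = (\<lambda>x y. R x \<triangleright> y), ne = (\<lambda>x y. R x \<triangleleft> y),
              nw = (\<lambda>x y. - (y \<triangleright> R x)), sw = (\<lambda>x y. - (y \<triangleleft> R x)) \<rparr>"
  have Q: "L_quadri_algebra scale ?Q"
    using assms by (rule L_dendriform_algebra.rota_baxter_L_quadri_algebra)
  note T = L_quadri_algebra.transpose and A = L_quadri_algebra.Sym_a
  have "L_quadri_algebra scale (transpose_quadri ?Q)" "L_quadri_algebra scale (Sym_a ?Q)"
       "L_quadri_algebra scale (Sym_b ?Q)" "L_quadri_algebra scale (Sym_c ?Q)"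
       "L_quadri_algebra scale (Sym_d ?Q)"
    \<comment> \<open>Each structure is now a word in the transpose and \<open>Sym_a\<close> applied
      to \<open>?Q\<close>, peeled off letter by letter.\<close>
    unfolding Sym_b_eq Sym_c_eq Sym_d_eq by (intro T A Q)+
  then show ?thesis
    \<comment> \<open>The signs in \<open>nw\<close> and \<open>sw\<close> of \<open>?Q\<close>
      cancel those of the symmetries: reversing and negating them yields
      \<open>x \<triangleright> R y\<close> and \<open>x \<triangleleft> R y\<close>.\<close>
    using Q by (intro exI[of _ ?Q])
      (simp add: Let_def transpose_quadri_def Sym_a_def Sym_b_def Sym_c_def Sym_d_def)
qed

end
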